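(* Let $X_1,\dots,X_d$ be independent with $X_i\sim\mathrm{Bern}(p_i)$, let $0\le k\le d$, and consider the squared recovery objective with action set $A=\mathbb{R}^d$ and loss $\ell(a,x)=\|a-x\|_2^2$. Then the naive-optimal contextual policy, i.e. the policy minimizing $R^N(\sigma)$ over all maps $\sigma:\{0,1\}^d\to\{I\subseteq[d]:|I|\le k\}$, is given by any $\sigma^N$ with $$\sigma^N(x)\in\operatorname{argmax}_{I\subseteq[d]:\,|I|\le k}\ \sum_{i\in I}(x_i-p_i)^2\qquad\text{for every }x\in\{0,1\}^d,$$ i.e., it reveals the $k$ coordinates with the largest "surprises" $(x_i-p_i)^2$.
   Context: A (contextual) highlighting policy $\sigma$ maps each realized instance $x$ to a set $I=\sigma(x)$ of at most $k$ coordinates; the agent observes $I$ and $X_I=(X_i)_{i\in I}$. The naive agent forms the belief $\mathbb{P}(\cdot\mid X_I)$ (ignoring the information contained in the selection of $I$) and plays the Bayes action $\hat a(I,X_I)\in\operatorname{argmin}_{a\in\mathbb{R}^d}\mathbb{E}[\|a-X\|_2^2\mid X_I]$, which under independence is $\hat a_i=X_i$ for $i\in I$ and $\hat a_i=p_i$ for $i\notin I$. The naive risk is $R^N(\sigma)=\mathbb{E}\big[\|\hat a(I,X_I)-X\|_2^2\big]$ with $I=\sigma(X)$. *)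

theory Defs
  imports "HOL-Probability.Probability"
begin

text \<open>
  A point of \<open>{0,1}\<^sup>d\<close> is a function \<open>'d \<Rightarrow> bool\<close>, where the finite type \<open>'d\<close> plays the role
  of the index set \<open>[d]\<close>. Actions live in \<open>real ^ 'd\<close>, into which \<open>{0,1}\<^sup>d\<close> is embedded
  by \<open>vec_of\<close>. The partial observation \<open>x\<^sub>I\<close> is \<open>restrict x I\<close>, so that a function of
  \<open>(I, restrict x I)\<close> cannot depend on unobserved coordinates.
\<close>

definition vec_of :: "('d \<Rightarrow> bool) \<Rightarrow> real ^ 'd::finite" where
  "vec_of x = (\<chi> i. of_bool (x i))"

definition loss :: "real ^ 'd::finite \<Rightarrow> ('d \<Rightarrow> bool) \<Rightarrow> real" where
  "loss a x = (norm (a - vec_of x))\<^sup>2"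

definition realization :: "('d \<Rightarrow> 'w \<Rightarrow> bool) \<Rightarrow> 'w \<Rightarrow> 'd \<Rightarrow> bool" where
  "realization X \<omega> = (\<lambda>i. X i \<omega>)"

definition policies :: "nat \<Rightarrow> (('d::finite \<Rightarrow> bool) \<Rightarrow> 'd set) set" where
  "policies k = {\<sigma>. \<forall>x. card (\<sigma> x) \<le> k}"

text \<open>
  The naive belief conditions on the event \<open>X\<^sub>I = y\<close> alone, not on the event that \<open>I\<close> was
  selected. If \<open>X\<^sub>I = y\<close> has probability zero, \<open>uniform_measure\<close> is the null measure, so
  every action is then a Bayes action.
\<close>

definition naive_belief ::
  "'w measure \<Rightarrow> ('d \<Rightarrow> 'w \<Rightarrow> bool) \<Rightarrow> 'd set \<Rightarrow> ('d \<Rightarrow> bool) \<Rightarrow> 'w measure" where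
  "naive_belief M X I y =
     uniform_measure M {\<omega> \<in> space M. restrict (realization X \<omega>) I = y}"

definition bayes_action ::
  "'w measure \<Rightarrow> ('d::finite \<Rightarrow> 'w \<Rightarrow> bool) \<Rightarrow> 'd set \<Rightarrow> ('d \<Rightarrow> bool) \<Rightarrow> real ^ 'd \<Rightarrow> bool" where
  "bayes_action M X I y =
     is_arg_min (\<lambda>a. \<integral>\<omega>. loss a (realization X \<omega>) \<partial>naive_belief M X I y) (\<lambda>_. True)"

definition naive_agent ::
  "'w measure \<Rightarrow> ('d::finite \<Rightarrow> 'w \<Rightarrow> bool) \<Rightarrow>
   ('d set \<Rightarrow> ('d \<Rightarrow> bool) \<Rightarrow> real ^ 'd) \<Rightarrow> bool" where
  "naive_agent M X act \<longleftrightarrow> (\<forall>I. \<forall>y \<in> I \<rightarrow>\<^sub>E UNIV. bayes_action M X I y (act I y))"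

definition naive_risk ::
  "'w measure \<Rightarrow> ('d::finite \<Rightarrow> 'w \<Rightarrow> bool) \<Rightarrow>
   ('d set \<Rightarrow> ('d \<Rightarrow> bool) \<Rightarrow> real ^ 'd) \<Rightarrow> (('d \<Rightarrow> bool) \<Rightarrow> 'd set) \<Rightarrow> real" where
  "naive_risk M X act \<sigma> =
     (\<integral>\<omega>. (let x = realization X \<omega>; I = \<sigma> x in loss (act I (restrict x I)) x) \<partial>M)"

definition naive_optimal ::
  "'w measure \<Rightarrow> ('d::finite \<Rightarrow> 'w \<Rightarrow> bool) \<Rightarrow>
   ('d set \<Rightarrow> ('d \<Rightarrow> bool) \<Rightarrow> real ^ 'd) \<Rightarrow> nat \<Rightarrow> (('d \<Rightarrow> bool) \<Rightarrow> 'd set) \<Rightarrow> bool" where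
  "naive_optimal M X act k = is_arg_min (naive_risk M X act) (\<lambda>\<sigma>. \<sigma> \<in> policies k)"

definition surprise :: "('d \<Rightarrow> real) \<Rightarrow> ('d \<Rightarrow> bool) \<Rightarrow> 'd \<Rightarrow> real" where
  "surprise p x i = (of_bool (x i) - p i)\<^sup>2"

definition max_surprise ::
  "('d::finite \<Rightarrow> real) \<Rightarrow> nat \<Rightarrow> ('d \<Rightarrow> bool) \<Rightarrow> 'd set \<Rightarrow> bool" where
  "max_surprise p k x = is_arg_max (\<lambda>I. \<Sum>i\<in>I. surprise p x i) (\<lambda>I. card I \<le> k)"

text \<open>
  \<open>I\<close> consists of \<open>k\<close> coordinates with the largest surprises. Ties may be broken arbitrarily,
  and since the constraint is \<open>card I \<le> k\<close>, coordinates of surprise zero may be left out.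
\<close>

definition reveals_largest ::
  "('d::finite \<Rightarrow> real) \<Rightarrow> nat \<Rightarrow> ('d \<Rightarrow> bool) \<Rightarrow> 'd set \<Rightarrow> bool" where
  "reveals_largest p k x I \<longleftrightarrow>
     card I \<le> k \<and>
     (\<forall>i\<in>I. \<forall>j\<in>-I. surprise p x j \<le> surprise p x i) \<and>
     (card I < k \<longrightarrow> (\<forall>j\<in>-I. surprise p x j = 0))"

end

theory Submission
  imports Defs
begin

text \<open>
  The squared loss is minimized exactly by the conditional mean, so independence forces
  \<open>act I x\<^sub>I\<close> to have coordinates \<open>x\<^sub>i\<close> for \<open>i \<in> I\<close> and \<open>p\<^sub>i\<close> for \<open>i \<notin> I\<close> at every
  \<open>x\<close> of positive probability. The loss at \<open>x\<close> is then the total surprise of \<open>x\<close> minus the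
  surprise of the coordinates in \<open>I\<close>, which can be minimized for each \<open>x\<close> separately.
\<close>

lemma loss_eq_sum: "loss a x = (\<Sum>i\<in>UNIV. (a $ i - of_bool (x i))\<^sup>2)"
  by (simp add: loss_def vec_of_def norm_vec_def L2_set_def sum_nonneg)

text \<open>Bias-variance decomposition: the loss is additive over coordinates, and
  \<open>m i * (1 - m i)\<close> is the variance of a Bernoulli variable with mean
  \<open>m i\<close>. Only the squared bias depends on \<open>a\<close>.\<close>

lemma (in prob_space) integral_loss:
  fixes Y :: "'d::finite \<Rightarrow> 'a \<Rightarrow> bool"
  assumes "\<And>i. Y i \<in> M \<rightarrow>\<^sub>M count_space UNIV"
  defines "m \<equiv> \<lambda>i. prob {\<omega> \<in> space M. Y i \<omega>}"
  shows "(\<integral>\<omega>. loss a (realization Y \<omega>) \<partial>M) = (\<Sum>i\<in>UNIV. (a $ i - m i)\<^sup>2 + m i * (1 - m i))"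
proof -
  have [measurable]: "Measurable.pred M (Y i)" for i
    using assms(1) by simp
  have int: "integrable M (\<lambda>\<omega>. indicator {\<omega> \<in> space M. Y i \<omega>} \<omega> :: real)" for i
    by (intro integrable_real_indicator) (auto simp: less_top[symmetric])
  have coord: "integrable M (\<lambda>\<omega>. (a $ i - of_bool (Y i \<omega>))\<^sup>2) \<and>
      (\<integral>\<omega>. (a $ i - of_bool (Y i \<omega>))\<^sup>2 \<partial>M) = (a $ i - m i)\<^sup>2 + m i * (1 - m i)" for i
  proof -
    \<comment> \<open>A 0/1 value equals its own square, so the square is affine in the
      indicator.\<close>
    let ?g = "\<lambda>\<omega>. (a $ i)\<^sup>2 + (1 - 2 * a $ i) * indicator {\<omega> \<in> space M. Y i \<omega>} \<omega>"
    have expand: "(a $ i - of_bool (Y i \<omega>))\<^sup>2 = ?g \<omega>" if "\<omega> \<in> space M" for \<omega>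
      using that by (simp add: indicator_def power2_eq_square algebra_simps)
    have "integrable M ?g"
      using int by (intro Bochner_Integration.integrable_add integrable_mult_right) auto
    moreover have "(\<integral>\<omega>. ?g \<omega> \<partial>M) = (a $ i)\<^sup>2 + (1 - 2 * a $ i) * m i"
      using int by (simp add: m_def prob_space)
    moreover have "(a $ i)\<^sup>2 + (1 - 2 * a $ i) * m i = (a $ i - m i)\<^sup>2 + m i * (1 - m i)"
      by (simp add: power2_eq_square algebra_simps)
    ultimately show ?thesis
      by (simp add: expand cong: Bochner_Integration.integrable_cong Bochner_Integration.integral_cong)
  qed
  then show ?thesis
    by (simp add: loss_eq_sum realization_def)
qed

text \<open>Comparing \<open>a\<close> with the vector of means cancels the variances, leaving
  squared distance at most 0. The space is arbitrary so that the result can be applied to the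
  conditional measure.\<close>

lemma (in prob_space) is_arg_min_loss_unique:
  fixes Y :: "'d::finite \<Rightarrow> 'a \<Rightarrow> bool"
  assumes Y: "\<And>i. Y i \<in> M \<rightarrow>\<^sub>M count_space UNIV"
    and min: "is_arg_min (\<lambda>a. \<integral>\<omega>. loss a (realization Y \<omega>) \<partial>M) (\<lambda>_. True) a"
  shows "a $ i = prob {\<omega> \<in> space M. Y i \<omega>}"
proof -
  define m where "m = (\<chi> i. prob {\<omega> \<in> space M. Y i \<omega>})"
  have "(\<integral>\<omega>. loss a (realization Y \<omega>) \<partial>M) \<le> (\<integral>\<omega>. loss m (realization Y \<omega>) \<partial>M)"
    using min by (auto simp: is_arg_min_linorder)
  then have "(\<Sum>i\<in>UNIV. (a $ i - m $ i)\<^sup>2) \<le> 0"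
    by (simp add: integral_loss[OF Y] m_def sum.distrib)
  then have "(\<Sum>i\<in>UNIV. (a $ i - m $ i)\<^sup>2) = 0"
    by (intro antisym sum_nonneg) auto
  then have "(a $ i - m $ i)\<^sup>2 = 0"
    by (subst (asm) sum_nonneg_eq_0_iff) auto
  then show ?thesis
    by (simp add: m_def)
qed

lemma realization_measurable:
  fixes X :: "'d::finite \<Rightarrow> 'w \<Rightarrow> bool"
  assumes "\<And>i. X i \<in> M \<rightarrow>\<^sub>M count_space UNIV"
  shows "realization X \<in> M \<rightarrow>\<^sub>M count_space UNIV"
proof -
  have [measurable]: "Measurable.pred M (X i)" for i
    using assms by simp
  have "{\<omega> \<in> space M. \<forall>i. X i \<omega> = x i} \<in> sets M" for x
    by measurable
  moreover have "realization X -` {x} \<inter> space M = {\<omega> \<in> space M. \<forall>i. X i \<omega> = x i}" for x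
    by (auto simp: realization_def)
  ultimately show ?thesis
    by (subst measurable_count_space_eq2) auto
qed

text \<open>Both observation events are boxes that differ only in side \<open>i\<close>, so the
  product formula for boxes gives the factorization.\<close>

lemma (in prob_space) indep_event_restrict:
  fixes X :: "'d::finite \<Rightarrow> 'a \<Rightarrow> bool"
  assumes indep: "indep_vars (\<lambda>_. count_space UNIV) X UNIV" and "i \<notin> I"
  shows "prob {\<omega> \<in> space M. restrict (realization X \<omega>) I = restrict x I \<and> X i \<omega>}
    = prob {\<omega> \<in> space M. restrict (realization X \<omega>) I = restrict x I} * prob {\<omega> \<in> space M. X i \<omega>}"
proof -
  \<comment> \<open>Sides of the box: \<open>B\<close> at \<open>i\<close>, the observed value on
    \<open>I\<close>, no constraint elsewhere. Taking \<open>B\<close> as \<open>{True}\<close> or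
    \<open>UNIV\<close> includes or drops the event \<open>X i\<close>.\<close>
  define A where "A = (\<lambda>B j. if j = i then B else if j \<in> I then {x j} else UNIV)"
  have factor: "prob (\<Inter>j. X j -` A B j \<inter> space M) =
      prob (X i -` B \<inter> space M) * (\<Prod>j\<in>UNIV - {i}. prob (X j -` A UNIV j \<inter> space M))" for B
  proof -
    have "prob (\<Inter>j. X j -` A B j \<inter> space M) = (\<Prod>j\<in>UNIV. prob (X j -` A B j \<inter> space M))"
      by (rule indep_varsD[OF indep]) auto
    also have "\<dots> = prob (X i -` A B i \<inter> space M) * (\<Prod>j\<in>UNIV - {i}. prob (X j -` A B j \<inter> space M))"
      by (rule prod.remove) auto
    also have "(\<Prod>j\<in>UNIV - {i}. prob (X j -` A B j \<inter> space M)) =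
        (\<Prod>j\<in>UNIV - {i}. prob (X j -` A UNIV j \<inter> space M))"
      by (rule prod.cong) (simp_all add: A_def)
    finally show ?thesis
      by (simp add: A_def)
  qed
  have restrict_eq: "restrict (realization X \<omega>) I = restrict x I \<longleftrightarrow> (\<forall>j\<in>I. X j \<omega> = x j)" for \<omega>
    unfolding realization_def restrict_def fun_eq_iff by meson
  have "X j \<omega> \<in> A B j \<longleftrightarrow> (j = i \<longrightarrow> X i \<omega> \<in> B) \<and> (j \<in> I \<longrightarrow> X j \<omega> = x j)" for B j \<omega>
    using \<open>i \<notin> I\<close> by (auto simp: A_def)
  then have inter: "(\<Inter>j. X j -` A B j \<inter> space M) =
      {\<omega> \<in> space M. restrict (realization X \<omega>) I = restrict x I \<and> X i \<omega> \<in> B}" for B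
    unfolding restrict_eq by blast
  have "{\<omega> \<in> space M. X i \<omega>} = X i -` {True} \<inter> space M"
    by auto
  \<comment> \<open>For \<open>B = UNIV\<close> the factor at \<open>i\<close> is 1, so the product
    over the other coordinates is the probability of the observation.\<close>
  then show ?thesis
    using factor[of "{True}", unfolded inter] factor[of UNIV, unfolded inter] by (simp add: prob_space)
qed

text \<open>Conditioning fixes the coordinates in \<open>I\<close>, and independence leaves the mean
  of the others unchanged. Positivity of \<open>x\<close> excludes the null measure, under which
  every action is Bayes.\<close>

lemma (in prob_space) bayes_action_eq:
  fixes X :: "'d::finite \<Rightarrow> 'a \<Rightarrow> bool"
  assumes indep: "indep_vars (\<lambda>_. count_space UNIV) X UNIV"
    and pos: "prob {\<omega> \<in> space M. realization X \<omega> = x} \<noteq> 0"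
    and bayes: "bayes_action M X I (restrict x I) a"
  shows "a $ i = (if i \<in> I then of_bool (x i) else prob {\<omega> \<in> space M. X i \<omega>})"
proof -
  define E where "E = {\<omega> \<in> space M. restrict (realization X \<omega>) I = restrict x I}"
  have X: "X j \<in> M \<rightarrow>\<^sub>M count_space UNIV" for j
    using indep by (simp add: indep_vars_def)
  then have [measurable]: "Measurable.pred M (X j)" for j
    by simp
  note [measurable] = realization_measurable[of X M, OF X]
  have E: "E \<in> sets M"
    unfolding E_def by measurable
  \<comment> \<open>Realizing \<open>x\<close> entails observing its restriction to
    \<open>I\<close>, so \<open>E\<close> inherits positive probability.\<close>
  have "prob {\<omega> \<in> space M. realization X \<omega> = x} \<le> prob E"
    using E by (intro finite_measure_mono) (auto simp: E_def)
  with pos have "prob E \<noteq> 0"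
    by (metis measure_nonneg order_antisym)
  then have E0: "emeasure M E \<noteq> 0"
    by (auto simp: measure_def)
  define N where "N = uniform_measure M E"
  interpret N: prob_space N
    unfolding N_def using E0 by (rule prob_space_uniform_measure) simp
  have XN: "X j \<in> N \<rightarrow>\<^sub>M count_space UNIV" for j
    using X by (simp add: N_def)
  have "a $ i = N.prob {\<omega> \<in> space N. X i \<omega>}"
    using bayes XN by (intro N.is_arg_min_loss_unique)
      (auto simp: bayes_action_def naive_belief_def N_def E_def)
  also have "\<dots> = prob (E \<inter> {\<omega> \<in> space M. X i \<omega>}) / prob E"
    using E0 E by (simp add: N_def measure_uniform_measure)
  also have "\<dots> = (if i \<in> I then of_bool (x i) else prob {\<omega> \<in> space M. X i \<omega>})"
  proof (cases "i \<in> I")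
    case True
    then have "E \<inter> {\<omega> \<in> space M. X i \<omega>} = (if x i then E else {})"
      by (auto simp: E_def realization_def restrict_def fun_eq_iff)
    then show ?thesis
      using True \<open>prob E \<noteq> 0\<close> by simp
  next
    case False
    have "E \<inter> {\<omega> \<in> space M. X i \<omega>} =
        {\<omega> \<in> space M. restrict (realization X \<omega>) I = restrict x I \<and> X i \<omega>}"
      by (auto simp: E_def)
    then show ?thesis
      using False \<open>prob E \<noteq> 0\<close> indep_event_restrict[OF indep False, of x] by (simp add: E_def)
  qed
  finally show ?thesis .
qed

lemma loss_eq_surprise:
  fixes x :: "'d::finite \<Rightarrow> bool"
  assumes "\<And>i. a $ i = (if i \<in> I then of_bool (x i) else p i)"
  shows "loss a x = (\<Sum>i\<in>UNIV. surprise p x i) - (\<Sum>i\<in>I. surprise p x i)"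
proof -
  have "loss a x = (\<Sum>i\<in>UNIV - I. surprise p x i)"
    unfolding loss_eq_sum
    by (rule sum.mono_neutral_cong_right)
      (auto simp: assms surprise_def power2_commute)
  then show ?thesis
    by (simp add: sum_diff)
qed

text \<open>There are finitely many realizations, so those of probability zero together form a null
  set.\<close>

lemma (in prob_space) AE_realization_pos:
  fixes X :: "'d::finite \<Rightarrow> 'a \<Rightarrow> bool"
  assumes "\<And>i. X i \<in> M \<rightarrow>\<^sub>M count_space UNIV"
  shows "AE \<omega> in M. prob {\<omega>' \<in> space M. realization X \<omega>' = realization X \<omega>} \<noteq> 0"
proof -
  note [measurable] = realization_measurable[of X M, OF assms]
  have "AE \<omega> in M. realization X \<omega> \<noteq> x"
    if "prob {\<omega> \<in> space M. realization X \<omega> = x} = 0" for x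
    using that by (subst (asm) prob_eq_0) auto
  then have "AE \<omega> in M. \<forall>x\<in>UNIV.
      prob {\<omega> \<in> space M. realization X \<omega> = x} = 0 \<longrightarrow> realization X \<omega> \<noteq> x"
    by (intro AE_finite_allI) auto
  then show ?thesis
    by eventually_elim auto
qed

text \<open>Exchange argument: swapping \<open>i\<close> for \<open>j\<close> keeps the set
  admissible, and so does adding \<open>j\<close> when there is room; neither can increase the
  maximal sum.\<close>

lemma max_surprise_reveals_largest:
  fixes x :: "'d::finite \<Rightarrow> bool"
  assumes "max_surprise p k x I"
  shows "reveals_largest p k x I"
proof -
  have card: "card I \<le> k"
    and max: "\<And>J. card J \<le> k \<Longrightarrow> (\<Sum>i\<in>J. surprise p x i) \<le> (\<Sum>i\<in>I. surprise p x i)"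
    using assms by (simp_all add: max_surprise_def is_arg_max_linorder)
  have le: "surprise p x j \<le> surprise p x i" if "i \<in> I" "j \<notin> I" for i j
  proof -
    have "card (insert j (I - {i})) = card I"
      using that card_Suc_Diff1[of I i] by (simp del: card_Diff_singleton)
    then have "(\<Sum>i\<in>insert j (I - {i}). surprise p x i) \<le> (\<Sum>i\<in>I. surprise p x i)"
      using card by (intro max) simp
    also have "\<dots> = surprise p x i + (\<Sum>i\<in>I - {i}. surprise p x i)"
      using that by (intro sum.remove) simp_all
    finally show ?thesis
      using that by simp
  qed
  have zero: "surprise p x j = 0" if "card I < k" "j \<notin> I" for j
  proof -
    have "(\<Sum>i\<in>insert j I. surprise p x i) \<le> (\<Sum>i\<in>I. surprise p x i)"
      using that by (intro max) simp
    then have "surprise p x j \<le> 0"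
      using that by simp
    then show ?thesis
      by (simp add: surprise_def)
  qed
  show ?thesis
    unfolding reveals_largest_def using card le zero by blast
qed

theorem lemma2:
  fixes M :: "'w measure"
    and X :: "'d::finite \<Rightarrow> 'w \<Rightarrow> bool"
    and p :: "'d \<Rightarrow> real"
    and k :: nat
    and act :: "'d set \<Rightarrow> ('d \<Rightarrow> bool) \<Rightarrow> real ^ 'd"
    and \<sigma>N :: "('d \<Rightarrow> bool) \<Rightarrow> 'd set"
  assumes "prob_space M"
    and "prob_space.indep_vars M (\<lambda>_. count_space UNIV) X UNIV"
    and "\<And>i. 0 \<le> p i \<and> p i \<le> 1"
    and "\<And>i. distr M (count_space UNIV) (X i) = measure_pmf (bernoulli_pmf (p i))"
    and "k \<le> CARD('d)"
    and "naive_agent M X act"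
    and "\<And>x. max_surprise p k x (\<sigma>N x)"
  shows "naive_optimal M X act k \<sigma>N \<and> (\<forall>x. reveals_largest p k x (\<sigma>N x))"
proof -
  interpret prob_space M by fact
  have X: "X i \<in> M \<rightarrow>\<^sub>M count_space UNIV" for i
    using assms(2) by (simp add: indep_vars_def)
  note real_meas = realization_measurable[of X M, OF X]
  have prob_X: "prob {\<omega> \<in> space M. X i \<omega>} = p i" for i
  proof -
    have "prob {\<omega> \<in> space M. X i \<omega>} = measure (distr M (count_space UNIV) (X i)) {True}"
      using X by (subst measure_distr) (auto intro: arg_cong[where f = prob])
    then show ?thesis
      using assms(3)[of i] assms(4)[of i] by (simp add: measure_pmf_single)
  qed
  \<comment> \<open>The loss that remains after revealing \<open>\<sigma> x\<close>: the total
    surprise of the hidden coordinates.\<close>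
  define kept where "kept = (\<lambda>\<sigma> x. (\<Sum>i\<in>UNIV. surprise p x i) - (\<Sum>i\<in>\<sigma> x. surprise p x i))"
  \<comment> \<open>A function of the realization takes finitely many values, hence the bound by a
    maximum.\<close>
  have integrable: "integrable M (\<lambda>\<omega>. f (realization X \<omega>))" for f :: "_ \<Rightarrow> real"
    using real_meas
    by (intro integrable_const_bound[where B = "Max (range (\<lambda>x. \<bar>f x\<bar>))"])
      (auto intro!: AE_I2 measurable_compose[OF real_meas])
  have risk: "naive_risk M X act \<sigma> = (\<integral>\<omega>. kept \<sigma> (realization X \<omega>) \<partial>M)" for \<sigma>
    unfolding naive_risk_def Let_def
  \<comment> \<open>Equality holds only almost everywhere, since \<open>act\<close> may be arbitrary
    on observations of probability zero.\<close>
  proof (rule integral_cong_AE)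
    show "AE \<omega> in M. loss (act (\<sigma> (realization X \<omega>)) (restrict (realization X \<omega>) (\<sigma> (realization X \<omega>))))
        (realization X \<omega>) = kept \<sigma> (realization X \<omega>)"
      using AE_realization_pos[of X, OF X]
    proof eventually_elim
      case (elim \<omega>)
      define x where "x = realization X \<omega>"
      have "bayes_action M X (\<sigma> x) (restrict x (\<sigma> x)) (act (\<sigma> x) (restrict x (\<sigma> x)))"
        using assms(6) by (auto simp: naive_agent_def)
      from bayes_action_eq[OF assms(2) elim[folded x_def] this] show ?case
        unfolding x_def[symmetric] kept_def by (intro loss_eq_surprise) (simp add: prob_X)
    qed
  qed (intro borel_measurable_integrable integrable)+
  have "naive_risk M X act \<sigma>N \<le> naive_risk M X act \<sigma>" if "\<sigma> \<in> policies k" for \<sigma>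
    unfolding risk
  \<comment> \<open>The comparison is pointwise: at each \<open>x\<close>, \<open>\<sigma> x\<close>
    is an admissible competitor of \<open>\<sigma>N x\<close>.\<close>
  proof (intro integral_mono integrable)
    fix \<omega>
    show "kept \<sigma>N (realization X \<omega>) \<le> kept \<sigma> (realization X \<omega>)"
      using that assms(7)[of "realization X \<omega>"]
      by (auto simp: kept_def policies_def max_surprise_def is_arg_max_linorder)
  qed
  moreover have "\<sigma>N \<in> policies k"
    using assms(7) by (auto simp: policies_def max_surprise_def is_arg_max_linorder)
  ultimately have "naive_optimal M X act k \<sigma>N"
    by (simp add: naive_optimal_def is_arg_min_linorder)
  then show ?thesis
    using assms(7) by (simp add: max_surprise_reveals_largest)
qed

end
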